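(* For any connected graph $G$ of order $n\ge 2$, $\gamma_{rI}(G)=2$ if and only if $G\in\Omega\cup\{P_2\}$ (up to isomorphism), where $\Omega$ is the family of graphs defined in the context and $P_2$ is the path on two vertices.
   Context: All graphs are finite and simple. For $f:V(G)\to\{0,1,2\}$, the weight is $\omega(f)=\sum_{v\in V(G)}f(v)$ and $V_i=\{v: f(v)=i\}$. An Italian dominating function of $G$ is a function $f:V(G)\to\{0,1,2\}$ such that every $v$ with $f(v)=0$ satisfies $\sum_{u\in N(v)}f(u)\ge 2$. A restrained Italian dominating (RID) function is an Italian dominating function for which the induced subgraph $G[V_0]$ has no isolated vertices; $\gamma_{rI}(G)$ is the minimum weight of an RID function of $G$. $\delta(G)$ denotes the minimum degree. Family $\Omega$: let $H$ be a complete bipartite graph of order $n\ge 3$ with partite sets $X$ and $Y$, $|X|\le|Y|$, such that $|X|\in\{1,2\}$ and $|Y|\ge 2$. Then $\Omega$ is the family of all graphs $G$ obtained from such an $H$ by adding some edges among the vertices in $Y$ such that $\delta(G[Y])\ge 1$. *)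

theory Defs
  imports "Graph_Theory.Graph_Theory"
begin

text \<open>A finite simple graph is a \<open>pair_graph\<close>: a finite, loop-free digraph whose arc relation
  is symmetric, each edge $uv$ being the two arcs \<open>(u, v)\<close> and \<open>(v, u)\<close>. Hence the out-degree
  of a vertex is its degree.\<close>

definition neighbourhood :: "('a, 'b) pre_digraph \<Rightarrow> 'a \<Rightarrow> 'a set" where
  "neighbourhood G v = {u. v \<rightarrow>\<^bsub>G\<^esub> u}"

definition isolated_vertex :: "('a, 'b) pre_digraph \<Rightarrow> 'a \<Rightarrow> bool" where
  "isolated_vertex G v \<longleftrightarrow> v \<in> verts G \<and> neighbourhood G v = {}"

text \<open>Meaningful for graphs with at least one vertex only.\<close>
definition min_degree :: "('a, 'b) pre_digraph \<Rightarrow> nat" where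
  "min_degree G = Min (out_degree G ` verts G)"

definition weight :: "'a pair_pre_digraph \<Rightarrow> ('a \<Rightarrow> nat) \<Rightarrow> nat" where
  "weight G f = (\<Sum>v\<in>pverts G. f v)"

definition level_set :: "'a pair_pre_digraph \<Rightarrow> ('a \<Rightarrow> nat) \<Rightarrow> nat \<Rightarrow> 'a set" where
  "level_set G f i = {v \<in> pverts G. f v = i}"

text \<open>The values of \<open>f\<close> outside the vertex set are unconstrained; none of the notions below
  depends on them.\<close>
definition italian_dominating :: "'a pair_pre_digraph \<Rightarrow> ('a \<Rightarrow> nat) \<Rightarrow> bool" where
  "italian_dominating G f \<longleftrightarrow>
     f ` pverts G \<subseteq> {0, 1, 2} \<and>
     (\<forall>v\<in>pverts G. f v = 0 \<longrightarrow> (\<Sum>u\<in>neighbourhood (with_proj G) v. f u) \<ge> 2)"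

definition restrained_italian_dominating :: "'a pair_pre_digraph \<Rightarrow> ('a \<Rightarrow> nat) \<Rightarrow> bool" where
  "restrained_italian_dominating G f \<longleftrightarrow>
     italian_dominating G f \<and>
     \<not> (\<exists>v. isolated_vertex (with_proj G \<restriction> level_set G f 0) v)"

definition gamma_rI :: "'a pair_pre_digraph \<Rightarrow> nat" where
  "gamma_rI G = (LEAST k. \<exists>f. restrained_italian_dominating G f \<and> weight G f = k)"

text \<open>The minimum is over a non-empty set.\<close>
lemma restrained_italian_dominating_const_1: "restrained_italian_dominating G (\<lambda>_. 1)"
  by (auto simp: restrained_italian_dominating_def italian_dominating_def level_set_def
      isolated_vertex_def)

text \<open>The library predicate for complete bipartite graphs hides the partite sets, which are
  needed here.\<close>
definition complete_bipartite_on :: "'a set \<Rightarrow> 'a set \<Rightarrow> 'a pair_pre_digraph \<Rightarrow> bool" where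
  "complete_bipartite_on X Y H \<longleftrightarrow>
     pair_graph H \<and> pverts H = X \<union> Y \<and> X \<inter> Y = {} \<and> parcs H = X \<times> Y \<union> Y \<times> X"

lemma complete_bipartite_on_iff_library:
  "K\<^bsub>m,n\<^esub> (with_proj H) \<longleftrightarrow> (\<exists>X Y. complete_bipartite_on X Y H \<and> card X = m \<and> card Y = n)"
  using pair_graphI_complete_bipartite[of m n H] pair_graph.pair_graphD_graph[of H]
  by (auto simp: complete_bipartite_on_def complete_bipartite_digraph_def)

definition Omega :: "'a pair_pre_digraph set" where
  "Omega = {G. pair_graph G \<and>
     (\<exists>H X Y. complete_bipartite_on X Y H \<and> card (pverts H) \<ge> 3 \<and> card X \<le> card Y \<and>
        card X \<in> {1, 2} \<and> card Y \<ge> 2 \<and>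
        pverts G = pverts H \<and> parcs H \<subseteq> parcs G \<and> parcs G - parcs H \<subseteq> Y \<times> Y \<and>
        min_degree (with_proj G \<restriction> Y) \<ge> 1)}"

definition path_graph :: "nat \<Rightarrow> nat pair_pre_digraph" where
  "path_graph n = \<lparr> pverts = {..<n},
     parcs = {(i, j). i < n \<and> j < n \<and> (j = Suc i \<or> i = Suc j)} \<rparr>"

end

theory Submission
  imports Defs
begin

text \<open>If a restrained Italian dominating function \<open>f\<close> has weight 2 and some vertex of value 0, then
  every such vertex sees the whole weight in its neighbourhood, so it is adjacent to every vertex of
  the support of \<open>f\<close>. The support has one or two elements and serves as \<open>X\<close>, with \<open>Y\<close> the zero set.
  If the support consists of two adjacent vertices, either one alone serves as \<open>X\<close> instead.\<close>

section \<open>Induced subgraphs and the family \<open>Omega\<close> in terms of arcs\<close>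

lemma neighbourhood_with_proj_iff [simp]:
  "u \<in> neighbourhood (with_proj G) v \<longleftrightarrow> (v, u) \<in> parcs G"
  by (simp add: neighbourhood_def)

lemma arcs_ends_induce_with_proj [simp]:
  "arcs_ends (with_proj G \<restriction> S) = parcs G \<inter> S \<times> S"
  by (auto simp: arcs_ends_conv induce_subgraph_def)

lemma isolated_vertex_induce_iff:
  "isolated_vertex (with_proj G \<restriction> S) v \<longleftrightarrow> v \<in> S \<and> (\<forall>w\<in>S. (v, w) \<notin> parcs G)"
  by (auto simp: isolated_vertex_def neighbourhood_def)

lemma min_degree_induce_ge_1_iff:
  assumes "finite (parcs G)" and "finite S" and "S \<noteq> {}"
  shows "min_degree (with_proj G \<restriction> S) \<ge> 1 \<longleftrightarrow> (\<forall>v\<in>S. \<exists>w\<in>S. (v, w) \<in> parcs G)"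
proof -
  have "out_degree (with_proj G \<restriction> S) v \<ge> 1 \<longleftrightarrow> (\<exists>w\<in>S. (v, w) \<in> parcs G)" if "v \<in> S" for v
  proof -
    have eq: "out_arcs (with_proj G \<restriction> S) v = {e \<in> parcs G. fst e = v \<and> snd e \<in> S}"
      using that by (auto simp: out_arcs_def induce_subgraph_def)
    \<comment> \<open>Finiteness matters because \<open>card\<close> is 0 on infinite sets, so a
      positive out-degree would not follow from the existence of an arc alone.\<close>
    have "finite {e \<in> parcs G. fst e = v \<and> snd e \<in> S}"
      using assms(1) by simp
    then show ?thesis
      unfolding out_degree_def eq
      by (force simp: Suc_le_eq card_gt_0_iff)
  qed
  then show ?thesis
    using assms(2,3) by (simp add: min_degree_def)
qed

text \<open>The bipartite graph \<open>H\<close> is determined by \<open>X\<close> and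
  \<open>Y\<close>, so it can be eliminated. Arcs outside \<open>H\<close> stay within
  \<open>Y\<close> exactly when no arc joins two vertices of \<open>X\<close>; the arcs from
  \<open>Y\<close> to \<open>X\<close> come from symmetry. This is the form in which membership in
  \<open>Omega\<close> is proved and used below.\<close>

lemma Omega_iff:
  assumes "pair_graph G"
  shows "G \<in> Omega \<longleftrightarrow>
    (\<exists>X Y. pverts G = X \<union> Y \<and> X \<inter> Y = {} \<and> card X \<in> {1, 2} \<and> card Y \<ge> 2 \<and>
      X \<times> Y \<subseteq> parcs G \<and> parcs G \<inter> X \<times> X = {} \<and> (\<forall>y\<in>Y. \<exists>z\<in>Y. (y, z) \<in> parcs G))"
    (is "_ \<longleftrightarrow> (\<exists>X Y. ?P X Y)")
proof -
  interpret pair_graph G by fact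
  show ?thesis
  proof
    assume "G \<in> Omega"
    then obtain H X Y where H: "complete_bipartite_on X Y H" "card X \<in> {1, 2}" "card Y \<ge> 2"
      "pverts G = pverts H" "parcs H \<subseteq> parcs G" "parcs G - parcs H \<subseteq> Y \<times> Y"
      "min_degree (with_proj G \<restriction> Y) \<ge> 1"
      unfolding Omega_def by blast
    have V: "pverts G = X \<union> Y" "X \<inter> Y = {}" "parcs H = X \<times> Y \<union> Y \<times> X"
      using H(1,4) by (auto simp: complete_bipartite_on_def)
    have "finite Y" "Y \<noteq> {}"
      using H(3) by (auto intro: card_ge_0_finite)
    then have "\<forall>y\<in>Y. \<exists>z\<in>Y. (y, z) \<in> parcs G"
      using H(7) min_degree_induce_ge_1_iff[OF pair_finite_arcs] by blast
    moreover have "X \<times> Y \<subseteq> parcs G" "parcs G \<inter> X \<times> X = {}"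
      using V H(5,6) by blast+
    ultimately show "\<exists>X Y. ?P X Y"
      using V(1,2) H(2,3) by blast
  next
    assume "\<exists>X Y. ?P X Y"
    then obtain X Y where P: "?P X Y" by blast
    define H where "H = \<lparr>pverts = X \<union> Y, parcs = X \<times> Y \<union> Y \<times> X\<rparr>"
    have fin: "finite X" "finite Y" "Y \<noteq> {}"
      using P by (auto intro: card_ge_0_finite)
    have "pair_graph H"
      using P fin unfolding H_def
      by unfold_locales (auto simp: symmetric_def sym_def)
    then have "complete_bipartite_on X Y H"
      using P by (simp add: complete_bipartite_on_def H_def)
    moreover have "card (pverts H) \<ge> 3" "card X \<le> card Y"
      using P fin by (auto simp: H_def card_Un_disjoint)
    moreover have "Y \<times> X \<subseteq> parcs G"
      using P by (auto intro: arcs_symmetric)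
    then have "parcs H \<subseteq> parcs G"
      using P by (simp add: H_def)
    moreover have "parcs G - parcs H \<subseteq> Y \<times> Y"
    proof
      fix e assume e: "e \<in> parcs G - parcs H"
      then have "fst e \<in> X \<union> Y" "snd e \<in> X \<union> Y"
        using P arc_fst_in_verts[of e] arc_snd_in_verts[of e] by auto
      with e P show "e \<in> Y \<times> Y"
        by (cases e) (auto simp: H_def)
    qed
    moreover have "min_degree (with_proj G \<restriction> Y) \<ge> 1"
      using P fin min_degree_induce_ge_1_iff[OF pair_finite_arcs] by blast
    ultimately show "G \<in> Omega"
      using P assms unfolding Omega_def
      by (intro CollectI conjI exI[of _ H] exI[of _ X] exI[of _ Y]) (simp_all add: H_def)
  qed
qed

section \<open>The lower bound 2 on the weight\<close>

lemma card_le_weight: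
  assumes "\<And>v. v \<in> pverts G \<Longrightarrow> f v > 0"
  shows "card (pverts G) \<le> weight G f"
  using sum_mono[of "pverts G" "\<lambda>_. 1" f] assms by (simp add: weight_def Suc_le_eq)

text \<open>A vertex of value 0 already has weight 2 in its neighbourhood; if there is none, each of
  the at least two vertices contributes at least 1.\<close>

lemma restrained_italian_dominating_weight_ge_2:
  assumes "pair_graph G" and "card (pverts G) \<ge> 2" and "restrained_italian_dominating G f"
  shows "weight G f \<ge> 2"
proof (cases "\<exists>v\<in>pverts G. f v = 0")
  case True
  interpret pair_graph G by fact
  obtain v where "v \<in> pverts G" "f v = 0"
    using True by blast
  then have "2 \<le> sum f (neighbourhood (with_proj G) v)"
    using assms(3) by (simp add: restrained_italian_dominating_def italian_dominating_def)
  also have "\<dots> \<le> weight G f"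
    unfolding weight_def using pair_finite_verts
    by (intro sum_mono2) (auto dest: in_arcsD2)
  finally show ?thesis .
next
  case False
  then have "card (pverts G) \<le> weight G f"
    by (intro card_le_weight) simp
  with assms(2) show ?thesis
    by simp
qed

text \<open>Since 2 is a lower bound, the minimum equals 2 once it is attained there. Conversely,
  the constant function 1 shows that the minimum is over a nonempty set, hence attained.\<close>

lemma gamma_rI_eq_2_iff_ex:
  assumes "pair_graph G" and "card (pverts G) \<ge> 2"
  shows "gamma_rI G = 2 \<longleftrightarrow> (\<exists>f. restrained_italian_dominating G f \<and> weight G f = 2)"
proof
  assume "gamma_rI G = 2"
  moreover have "\<exists>k f. restrained_italian_dominating G f \<and> weight G f = k"
    using restrained_italian_dominating_const_1 by blast
  then have "\<exists>f. restrained_italian_dominating G f \<and> weight G f = gamma_rI G"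
    unfolding gamma_rI_def by (rule LeastI_ex)
  ultimately show "\<exists>f. restrained_italian_dominating G f \<and> weight G f = 2"
    by simp
next
  assume "\<exists>f. restrained_italian_dominating G f \<and> weight G f = 2"
  then show "gamma_rI G = 2"
    unfolding gamma_rI_def
    by (rule Least_equality) (use restrained_italian_dominating_weight_ge_2[OF assms] in blast)
qed

section \<open>Functions of weight 2 and membership in \<open>Omega\<close>\<close>

lemma weight_2_imp_Omega:
  assumes "pair_graph G" and f: "restrained_italian_dominating G f" "weight G f = 2"
    and zero: "\<exists>v\<in>pverts G. f v = 0"
  shows "G \<in> Omega"
proof -
  interpret pair_graph G by fact
  define X where "X = {v \<in> pverts G. f v \<noteq> 0}"
  define Y where "Y = {v \<in> pverts G. f v = 0}"
  have V: "pverts G = X \<union> Y" "X \<inter> Y = {}"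
    by (auto simp: X_def Y_def)
  have fin: "finite X" "finite Y"
    using pair_finite_verts by (auto simp: X_def Y_def)
  have Y_deg: "\<forall>y\<in>Y. \<exists>z\<in>Y. (y, z) \<in> parcs G"
    using f(1) unfolding restrained_italian_dominating_def isolated_vertex_induce_iff
      level_set_def Y_def by blast
  have "card Y \<ge> 2"
  proof -
    obtain y z where "y \<in> Y" "z \<in> Y" "(y, z) \<in> parcs G"
      using zero Y_deg by (auto simp: Y_def)
    moreover then have "y \<noteq> z"
      using pair_no_loops[of "(y, z)"] by auto
    ultimately show ?thesis
      using card_mono[OF fin(2), of "{y, z}"] by simp
  qed
  have sum_X: "sum f X = 2"
  proof -
    have "sum f (pverts G) = sum f X"
      using pair_finite_verts by (intro sum.mono_neutral_right) (auto simp: X_def)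
    with f(2) show ?thesis
      by (simp add: weight_def)
  qed
  \<comment> \<open>Every vertex of \<open>X\<close> has value at least 1, so the total 2 leaves
    room for at most two of them.\<close>
  have "(\<Sum>x\<in>X. 1) \<le> sum f X"
    by (intro sum_mono) (simp add: X_def Suc_le_eq)
  moreover have "X \<noteq> {}"
    using sum_X by auto
  ultimately have card_X: "card X \<in> {1, 2}"
    using sum_X fin card_gt_0_iff[of X] by force
  \<comment> \<open>The neighbourhood of \<open>y\<close> uses up the whole weight 2; a
    non-neighbour \<open>x\<close> of positive value would push the total above 2.\<close>
  have XY: "(x, y) \<in> parcs G" if "x \<in> X" "y \<in> Y" for x y
  proof (rule ccontr)
    let ?N = "neighbourhood (with_proj G) y"
    assume "(x, y) \<notin> parcs G"
    then have "x \<notin> ?N"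
      using arcs_symmetric by auto
    moreover have "finite ?N"
      by (rule finite_subset[OF _ pair_finite_verts]) (auto dest: in_arcsD2)
    ultimately have "f x + sum f ?N = sum f (insert x ?N)"
      by simp
    also have "\<dots> \<le> weight G f"
      unfolding weight_def using pair_finite_verts that(1)
      by (intro sum_mono2) (auto simp: X_def dest: in_arcsD2)
    finally have "f x + sum f ?N \<le> 2"
      using f(2) by simp
    moreover have "sum f ?N \<ge> 2"
      using f(1) that(2)
      by (simp add: restrained_italian_dominating_def italian_dominating_def Y_def)
    ultimately show False
      using that(1) by (simp add: X_def)
  qed
  show ?thesis
  proof (cases "parcs G \<inter> X \<times> X = {}")
    case True
    then show ?thesis
      unfolding Omega_iff[OF assms(1)]
      using V card_X \<open>card Y \<ge> 2\<close> XY Y_deg by (intro exI[of _ X] exI[of _ Y]) auto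
  next
    case False
    then obtain a b where ab: "a \<in> X" "b \<in> X" "(a, b) \<in> parcs G"
      by blast
    then have "a \<noteq> b"
      using pair_no_loops[of "(a, b)"] by auto
    then have X: "X = {a, b}"
      using ab card_X fin card_subset_eq[of X "{a, b}"] card_mono[of X "{a, b}"] by auto
    have "b \<notin> Y" "a \<notin> Y"
      using V(2) ab by auto
    \<comment> \<open>The new parts are \<open>{a}\<close> and \<open>insert b Y\<close>. The vertex
      \<open>y\<close> keeps \<open>b\<close> from being isolated in the enlarged part, and the arc
      from \<open>a\<close> to \<open>b\<close> completes the join.\<close>
    moreover obtain y where "y \<in> Y" "(b, y) \<in> parcs G"
      using zero ab XY by (auto simp: Y_def)
    ultimately show ?thesis
      unfolding Omega_iff[OF assms(1)]
      using V X \<open>a \<noteq> b\<close> ab \<open>card Y \<ge> 2\<close> XY Y_deg fin pair_no_loops[of "(a, a)"]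
        arcs_symmetric
      by (intro exI[of _ "{a}"] exI[of _ "insert b Y"]) auto
  qed
qed

lemma Omega_imp_weight_2:
  assumes "G \<in> Omega"
  shows "\<exists>f. restrained_italian_dominating G f \<and> weight G f = 2"
proof -
  have pg: "pair_graph G"
    using assms by (simp add: Omega_def)
  then interpret pair_graph G .
  obtain X Y where P: "pverts G = X \<union> Y" "X \<inter> Y = {}" "card X \<in> {1, 2}"
    "X \<times> Y \<subseteq> parcs G" "\<forall>y\<in>Y. \<exists>z\<in>Y. (y, z) \<in> parcs G"
    using assms unfolding Omega_iff[OF pg] by blast
  \<comment> \<open>The weight 2 is split evenly over \<open>X\<close>: value 2 on a single vertex,
    or 1 on each of two. Both values are positive, so the zero set is exactly \<open>Y\<close>, and
    each vertex of \<open>Y\<close> sees all of \<open>X\<close>.\<close>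
  define f where "f v = (if v \<in> X then 2 div card X else 0)" for v
  have sum_X: "sum f X = 2"
    using P(3) by (auto simp: f_def)
  have "finite X"
    using P(1) pair_finite_verts by simp
  have "weight G f = sum f X"
    unfolding weight_def P(1) using \<open>finite X\<close> pair_finite_verts P(1)
    by (intro sum.mono_neutral_right) (auto simp: f_def)
  moreover have level_0: "level_set G f 0 = Y"
    using P(1-3) by (auto simp: level_set_def f_def)
  moreover have "2 \<le> sum f (neighbourhood (with_proj G) y)" if "y \<in> Y" for y
  proof -
    have "finite (neighbourhood (with_proj G) y)"
      by (rule finite_subset[OF _ pair_finite_verts]) (auto dest: in_arcsD2)
    then have "sum f X \<le> sum f (neighbourhood (with_proj G) y)"
      using P(4) that arcs_symmetric by (intro sum_mono2) auto
    with sum_X show ?thesis by simp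
  qed
  then have "italian_dominating G f"
    using level_0 P(3) unfolding italian_dominating_def level_set_def by (auto simp: f_def)
  ultimately have "restrained_italian_dominating G f" "weight G f = 2"
    using P(5) sum_X
    by (auto simp: restrained_italian_dominating_def isolated_vertex_induce_iff)
  then show ?thesis by blast
qed

text \<open>The order-two alternative accounts for functions without zeros: weight 2 then allows
  only two vertices, and on two vertices the constant function 1 has weight 2.\<close>

lemma gamma_rI_eq_2_iff:
  assumes "pair_graph G" and "card (pverts G) \<ge> 2"
  shows "gamma_rI G = 2 \<longleftrightarrow> G \<in> Omega \<or> card (pverts G) = 2"
proof
  assume "gamma_rI G = 2"
  then obtain f where f: "restrained_italian_dominating G f" "weight G f = 2"
    using gamma_rI_eq_2_iff_ex[OF assms] by blast
  show "G \<in> Omega \<or> card (pverts G) = 2"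
  proof (cases "\<exists>v\<in>pverts G. f v = 0")
    case True
    with assms(1) f show ?thesis
      by (blast intro: weight_2_imp_Omega)
  next
    case False
    then have "card (pverts G) \<le> weight G f"
      by (intro card_le_weight) simp
    with assms(2) f(2) show ?thesis
      by simp
  qed
next
  assume "G \<in> Omega \<or> card (pverts G) = 2"
  moreover have "weight G (\<lambda>_. 1) = card (pverts G)"
    by (simp add: weight_def)
  ultimately show "gamma_rI G = 2"
    unfolding gamma_rI_eq_2_iff_ex[OF assms]
    using Omega_imp_weight_2 restrained_italian_dominating_const_1 by metis
qed

section \<open>Isomorphism of graphs and invariance of \<open>Omega\<close>\<close>

text \<open>An isomorphism in the library also carries an arc map and new head and tail functions.
  In a pair digraph an arc is its own pair of ends, so the vertex map alone determines the
  image.\<close>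

lemma digraph_iso_with_proj_iff:
  assumes "pair_wf_digraph G"
  shows "digraph_iso (with_proj G) (with_proj H) \<longleftrightarrow>
    (\<exists>h. inj_on h (pverts G) \<and> pverts H = h ` pverts G \<and> parcs H = map_prod h h ` parcs G)"
proof -
  interpret pair_wf_digraph G by fact
  show ?thesis
  proof
    assume "digraph_iso (with_proj G) (with_proj H)"
    then obtain k where k: "digraph_isomorphism k" "with_proj H = app_iso k (with_proj G)"
      by (auto simp: digraph_iso_def)
    \<comment> \<open>Passing from arcs to \<open>arcs_ends\<close> removes the arc map of
      \<open>k\<close> from the description of \<open>H\<close>.\<close>
    have "pverts H = verts (app_iso k (with_proj G))" "parcs H = arcs_ends (app_iso k (with_proj G))"
      unfolding k(2)[symmetric] by simp_all
    then have "pverts H = iso_verts k ` pverts G"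
      "parcs H = map_prod (iso_verts k) (iso_verts k) ` parcs G"
      using arcs_ends_app_iso_eq[OF k(1)] by (simp_all add: map_prod_def)
    with digraph_isomorphism_inj_on_verts[OF k(1)]
    show "\<exists>h. inj_on h (pverts G) \<and> pverts H = h ` pverts G \<and> parcs H = map_prod h h ` parcs G"
      by blast
  next
    assume "\<exists>h. inj_on h (pverts G) \<and> pverts H = h ` pverts G \<and> parcs H = map_prod h h ` parcs G"
    then obtain h where h: "inj_on h (pverts G)" "pverts H = h ` pverts G"
      "parcs H = map_prod h h ` parcs G"
      by blast
    define k where
      "k = \<lparr>iso_verts = h, iso_arcs = map_prod h h, iso_head = snd, iso_tail = fst\<rparr>"
    have "parcs G \<subseteq> pverts G \<times> pverts G"
      by (auto dest: in_arcsD1 in_arcsD2)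
    then have "inj_on (map_prod h h) (parcs G)"
      using map_prod_inj_on[OF h(1) h(1)] by (rule inj_on_subset[rotated])
    then have "digraph_isomorphism k"
      using h(1) wf_digraph_axioms by (simp add: digraph_isomorphism_def k_def)
    moreover have "with_proj H = app_iso k (with_proj G)"
      by (simp add: app_iso_def k_def with_proj_def h)
    ultimately show "digraph_iso (with_proj G) (with_proj H)"
      unfolding digraph_iso_def by blast
  qed
qed

text \<open>Finiteness and symmetry pass to the image under any vertex map; the absence of loops
  uses injectivity.\<close>

lemma pair_graph_digraph_iso:
  assumes "pair_graph G" and "digraph_iso (with_proj G) (with_proj H)"
  shows "pair_graph H"
proof -
  interpret pair_graph G by fact
  obtain h where h: "inj_on h (pverts G)" "pverts H = h ` pverts G"
    "parcs H = map_prod h h ` parcs G"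
    using assms(2) unfolding digraph_iso_with_proj_iff[OF pair_wf_digraph_axioms] by blast
  show ?thesis
  proof
    fix e assume "e \<in> parcs H"
    then obtain u v where e: "e = (h u, h v)" "(u, v) \<in> parcs G"
      unfolding h(3) by auto
    show "fst e \<in> pverts H" "snd e \<in> pverts H"
      using e in_arcsD1 in_arcsD2 by (auto simp: h(2))
    show "fst e \<noteq> snd e"
      using e in_arcsD1[OF e(2)] in_arcsD2[OF e(2)] h(1) pair_no_loops[OF e(2)]
      by (auto dest: inj_onD)
  next
    show "finite (pverts H)" "finite (parcs H)"
      using pair_finite_verts pair_finite_arcs by (simp_all add: h)
  next
    show "symmetric (with_proj H)"
      using arcs_symmetric by (force simp: symmetric_def sym_def h(3))
  qed
qed

lemma Omega_digraph_iso:
  assumes "G \<in> Omega" and iso: "digraph_iso (with_proj G) (with_proj H)"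
  shows "H \<in> Omega"
proof -
  have pg: "pair_graph G"
    using assms by (simp add: Omega_def)
  then interpret pair_graph G .
  obtain h where h: "inj_on h (pverts G)" "pverts H = h ` pverts G"
    "parcs H = map_prod h h ` parcs G"
    using iso unfolding digraph_iso_with_proj_iff[OF pair_wf_digraph_axioms] by blast
  obtain X Y where P: "pverts G = X \<union> Y" "X \<inter> Y = {}" "card X \<in> {1, 2}" "card Y \<ge> 2"
    "X \<times> Y \<subseteq> parcs G" "parcs G \<inter> X \<times> X = {}" "\<forall>y\<in>Y. \<exists>z\<in>Y. (y, z) \<in> parcs G"
    using assms(1) unfolding Omega_iff[OF pg] by blast
  have inj: "inj_on h X" "inj_on h Y"
    using h(1) P(1) by (auto intro: inj_on_subset)
  have arc_iff: "(h u, h v) \<in> parcs H \<longleftrightarrow> (u, v) \<in> parcs G"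
    if "u \<in> pverts G" "v \<in> pverts G" for u v
  proof
    assume "(h u, h v) \<in> parcs H"
    then obtain u' v' where "h u = h u'" "h v = h v'" "(u', v') \<in> parcs G"
      unfolding h(3) by auto
    moreover then have "u = u'" "v = v'"
      using that in_arcsD1 in_arcsD2 inj_onD[OF h(1)] by blast+
    ultimately show "(u, v) \<in> parcs G"
      by simp
  qed (auto simp: h(3))
  have "pverts H = h ` X \<union> h ` Y"
    using h(2) P(1) by auto
  moreover have "h ` X \<inter> h ` Y = {}"
    using inj_on_image_Int[OF h(1), of X Y] P(1,2) by simp
  moreover have "card (h ` X) \<in> {1, 2}" "card (h ` Y) \<ge> 2"
    using P(3,4) by (simp_all add: card_image inj)
  moreover have "h ` X \<times> h ` Y \<subseteq> parcs H" "parcs H \<inter> h ` X \<times> h ` X = {}"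
    using P(1,5,6) arc_iff by auto
  moreover have "\<forall>y\<in>h ` Y. \<exists>z\<in>h ` Y. (y, z) \<in> parcs H"
    using P(1,7) arc_iff by auto
  ultimately show ?thesis
    unfolding Omega_iff[OF pair_graph_digraph_iso[OF pg iso]] by blast
qed

text \<open>Supplies a copy on natural numbers, the vertex type over which the final statement takes
  \<open>Omega\<close>.\<close>

lemma ex_digraph_iso_nat:
  assumes "pair_fin_digraph G"
  obtains H :: "nat pair_pre_digraph" where "digraph_iso (with_proj G) (with_proj H)"
proof -
  interpret pair_fin_digraph G by fact
  obtain h :: "'a \<Rightarrow> nat" where "inj_on h (pverts G)"
    using finite_imp_inj_to_nat_seg[OF pair_finite_verts] by blast
  then have "digraph_iso (with_proj G)
      (with_proj \<lparr>pverts = h ` pverts G, parcs = map_prod h h ` parcs G\<rparr>)"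
    unfolding digraph_iso_with_proj_iff[OF pair_wf_digraph_axioms] by auto
  then show thesis
    by (rule that)
qed

lemma digraph_iso_path_graph_2_iff:
  assumes "pair_graph G" and "connected (with_proj G)"
  shows "digraph_iso (with_proj G) (with_proj (path_graph 2)) \<longleftrightarrow> card (pverts G) = 2"
proof -
  interpret pair_graph G by fact
  have P2: "pverts (path_graph 2) = {0, 1}" "parcs (path_graph 2) = {(0, 1), (1, 0)}"
    by (auto simp: path_graph_def less_2_cases_iff)
  show ?thesis
  proof
    assume "digraph_iso (with_proj G) (with_proj (path_graph 2))"
    then obtain h where h: "inj_on h (pverts G)" "pverts (path_graph 2) = h ` pverts G"
      unfolding digraph_iso_with_proj_iff[OF pair_wf_digraph_axioms] by blast
    show "card (pverts G) = 2"
      using card_image[OF h(1)] unfolding h(2)[symmetric] P2 by simp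
  next
    assume "card (pverts G) = 2"
    then obtain a b where ab: "pverts G = {a, b}" "a \<noteq> b"
      by (auto simp: card_2_iff)
    have "a \<rightarrow>\<^sup>*\<^bsub>with_proj G\<^esub> b"
      using symmetric_connected_imp_strongly_connected[OF pair_sym_arcs assms(2)] ab
      by (auto simp: strongly_connected_def)
    \<comment> \<open>This is the first arc of a walk from \<open>a\<close> to \<open>b\<close>,
      nontrivial because the two differ. Without loops its end can only be \<open>b\<close>.\<close>
    then obtain c where "(a, c) \<in> parcs G"
      using ab(2) by (cases rule: converse_reachable_cases) auto
    moreover then have "c = b"
      using ab in_arcsD2[of a c] pair_no_loops[of "(a, c)"] by auto
    ultimately have "(a, b) \<in> parcs G" "(b, a) \<in> parcs G"
      using arcs_symmetric by auto
    moreover have "parcs G \<subseteq> {(a, b), (b, a)}"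
    proof
      fix e assume "e \<in> parcs G"
      then show "e \<in> {(a, b), (b, a)}"
        using ab arc_fst_in_verts[of e] arc_snd_in_verts[of e] pair_no_loops[of e]
        by (cases e) auto
    qed
    ultimately have "parcs G = {(a, b), (b, a)}"
      by blast
    then have "inj_on (\<lambda>v. if v = a then 0 else 1 :: nat) (pverts G)"
      "pverts (path_graph 2) = (\<lambda>v. if v = a then 0 else 1 :: nat) ` pverts G"
      "parcs (path_graph 2) = map_prod (\<lambda>v. if v = a then 0 else 1 :: nat)
         (\<lambda>v. if v = a then 0 else 1 :: nat) ` parcs G"
      using ab by (auto simp: P2)
    then show "digraph_iso (with_proj G) (with_proj (path_graph 2))"
      unfolding digraph_iso_with_proj_iff[OF pair_wf_digraph_axioms] by blast
  qed
qed

theorem theorem4p1: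
  fixes G :: "'a pair_pre_digraph"
  assumes "pair_graph G"
    and "connected (with_proj G)"
    and "card (pverts G) \<ge> 2"
  shows "gamma_rI G = 2 \<longleftrightarrow>
    (\<exists>H \<in> (Omega :: nat pair_pre_digraph set) \<union> {path_graph 2}.
       digraph_iso (with_proj G) (with_proj H))"
proof -
  interpret pair_graph G by fact
  \<comment> \<open>The two occurrences of \<open>Omega\<close> have different vertex types,
    \<open>'a\<close> and \<open>nat\<close>; invariance under isomorphism, used in both directions,
    links them.\<close>
  have "G \<in> Omega \<longleftrightarrow>
    (\<exists>H\<in>(Omega :: nat pair_pre_digraph set). digraph_iso (with_proj G) (with_proj H))"
  proof
    assume "G \<in> Omega"
    then show "\<exists>H\<in>(Omega :: nat pair_pre_digraph set). digraph_iso (with_proj G) (with_proj H)"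
      using ex_digraph_iso_nat[OF pair_fin_digraph_axioms] Omega_digraph_iso by metis
  next
    assume "\<exists>H\<in>(Omega :: nat pair_pre_digraph set). digraph_iso (with_proj G) (with_proj H)"
    then show "G \<in> Omega"
      using Omega_digraph_iso digraph_iso_swap wf_digraph_axioms by metis
  qed
  then show ?thesis
    using gamma_rI_eq_2_iff[OF assms(1,3)] digraph_iso_path_graph_2_iff[OF assms(1,2)] by blast
qed

end
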